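(* Let $0\to(M,0,T_M)\xrightarrow{i}(\hat{\mathfrak g},[\cdot,\cdot,\cdot]_{\hat{\mathfrak g}},\hat T)\xrightarrow{p}(\mathfrak g,[\cdot,\cdot,\cdot],T)\to0$ be an abelian extension of Rota-Baxter $3$-Lie algebras of weight $\lambda$, with $M$ identified with $i(M)$. For a section $s:\mathfrak g\to\hat{\mathfrak g}$ (a linear map with $p\circ s=\mathrm{Id}_{\mathfrak g}$) put $\rho(x,y)m=[s(x),s(y),i(m)]_{\hat{\mathfrak g}}$, $\psi(x,y,z)=[s(x),s(y),s(z)]_{\hat{\mathfrak g}}-s([x,y,z])$ and $\chi(x)=\hat T(s(x))-s(T(x))$ for $x,y,z\in\mathfrak g$, $m\in M$. Then: (a) different choices of the section $s$ give the same representation $(M,\rho,T_M)$ of $(\mathfrak g,[\cdot,\cdot,\cdot],T)$; (b) the cohomology class of the $2$-cocycle $(\psi,\chi)$ in the second cohomology group of the Rota-Baxter $3$-Lie algebra $(\mathfrak g,[\cdot,\cdot,\cdot],T)$ with coefficients in $(M,\rho,T_M)$ does not depend on the choice of the section $s$.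
   Context: Let $k$ be a field of characteristic $0$; vector spaces are over $k$; $\lambda\in k$. A $3$-Lie algebra is a vector space $\mathfrak g$ with a linear map $[\cdot,\cdot,\cdot]:\wedge^3\mathfrak g\to\mathfrak g$ such that $[x_1,x_2,[x_3,x_4,x_5]]=[[x_1,x_2,x_3],x_4,x_5]+[x_3,[x_1,x_2,x_4],x_5]+[x_3,x_4,[x_1,x_2,x_5]]$. A representation on $M$ is a linear map $\rho:\wedge^2\mathfrak g\to\mathfrak{gl}(M)$ with $\rho(x_1,x_2)\rho(x_3,x_4)=\rho([x_1,x_2,x_3],x_4)+\rho(x_3,[x_1,x_2,x_4])+\rho(x_3,x_4)\rho(x_1,x_2)$ and $\rho(x_1,[x_2,x_3,x_4])=\rho(x_3,x_4)\rho(x_1,x_2)-\rho(x_2,x_4)\rho(x_1,x_3)+\rho(x_2,x_3)\rho(x_1,x_4)$. A Rota-Baxter $3$-Lie algebra of weight $\lambda$ is a $3$-Lie algebra with a linear map $T:\mathfrak g\to\mathfrak g$ such that $[T(x),T(y),T(z)]=T([x,y,z]_T)$, where $[x,y,z]_T:=[T(x),T(y),z]+[T(x),y,T(z)]+[x,T(y),T(z)]+\lambda[T(x),y,z]+\lambda[x,T(y),z]+\lambda[x,y,T(z)]+\lambda^2[x,y,z]$. Morphisms are $3$-Lie algebra homomorphisms commuting with the operators. A representation is a triple $(M,\rho,T_M)$ with $(M,\rho)$ a representation of the $3$-Lie algebra and $T_M\in\mathrm{End}(M)$ satisfying $\rho(T(x),T(y))T_M(m)=T_M\big(\rho(T(x),T(y))m+\rho(T(x),y)T_M(m)+\rho(x,T(y))T_M(m)+\lambda\rho(T(x),y)m+\lambda\rho(x,T(y))m+\lambda\rho(x,y)T_M(m)+\lambda^2\rho(x,y)m\big)$.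 A vector space $M$ with $T_M\in\mathrm{End}(M)$ is regarded as a Rota-Baxter $3$-Lie algebra $(M,0,T_M)$ with zero bracket. An abelian extension of $(\mathfrak g,[\cdot,\cdot,\cdot],T)$ by $(M,0,T_M)$ is a short exact sequence $0\to M\xrightarrow{i}\hat{\mathfrak g}\xrightarrow{p}\mathfrak g\to0$ of morphisms of Rota-Baxter $3$-Lie algebras of weight $\lambda$ such that $[u,i(m),i(n)]_{\hat{\mathfrak g}}=0$ for all $u\in\hat{\mathfrak g}$, $m,n\in M$. It is known that, for any section $s$, $(M,\rho,T_M)$ is a representation of $(\mathfrak g,[\cdot,\cdot,\cdot],T)$ and $(\psi,\chi)$ is a $2$-cocycle as defined below. Second cohomology group. Put $\rho_T(x,y)m=\rho(T(x),T(y))m-T_M\big(\rho(T(x),y)m+\rho(x,T(y))m+\lambda\rho(x,y)m\big)$. The $1$-cochains are $\mathrm{Hom}(\mathfrak g,M)\oplus M$ and the $2$-cochains are $\mathrm{Hom}(\wedge^3\mathfrak g,M)\oplus\mathrm{Hom}(\mathfrak g,M)$. The differentials are $d^1(f,a)=(\delta^1f,-\partial^0a-\Phi^1f)$ with $\partial^0=0$, and $d^2(f,g)=(\delta^2f,-\partial^1g-\Phi^2f)$, where $(\delta^1f)(x,y,z)=-f([x,y,z])+\rho(x,y)f(z)+\rho(y,z)f(x)+\rho(z,x)f(y)$; $\Phi^1f=f\circ T-T_M\circ f$; $(\delta^2f)(x_1,\dots,x_5)=-f([x_1,x_2,x_3],x_4,x_5)-f(x_3,[x_1,x_2,x_4],x_5)-f(x_3,x_4,[x_1,x_2,x_5])+f(x_1,x_2,[x_3,x_4,x_5])+\rho(x_1,x_2)f(x_3,x_4,x_5)-\rho(x_3,x_4)f(x_1,x_2,x_5)-\rho(x_4,x_5)f(x_1,x_2,x_3)-\rho(x_5,x_3)f(x_1,x_2,x_4)$;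 $(\partial^1g)(x,y,z)=-g([x,y,z]_T)+\rho_T(x,y)g(z)+\rho_T(y,z)g(x)+\rho_T(z,x)g(y)$; $(\Phi^2f)(x,y,z)=f(T(x),T(y),T(z))-T_M\big(f(T(x),T(y),z)+f(T(x),y,T(z))+f(x,T(y),T(z))+\lambda f(T(x),y,z)+\lambda f(x,T(y),z)+\lambda f(x,y,T(z))+\lambda^2f(x,y,z)\big)$. The second cohomology group is $\ker d^2/\operatorname{im}d^1$. *)

theory Defs
  imports
    Complex_Main
    "HOL-Library.Function_Algebras"
    "HOL-Library.Product_Plus"
    "HOL-Algebra.Coset"
begin

text \<open>
  Vector spaces over a field of type \<^typ>\<open>'k\<close> are whole types with an explicit scalar multiplication,
  as in the locale \<^locale>\<open>vector_space\<close>. A linear map out of an exterior power is an alternating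
  multilinear map, in curried form.
\<close>

definition alternating_bilinear ::
  "('k::field \<Rightarrow> 'a::ab_group_add \<Rightarrow> 'a) \<Rightarrow> ('k \<Rightarrow> 'b::ab_group_add \<Rightarrow> 'b) \<Rightarrow>
   ('a \<Rightarrow> 'a \<Rightarrow> 'b) \<Rightarrow> bool" where
  "alternating_bilinear s1 s2 f \<longleftrightarrow>
     (\<forall>y. Vector_Spaces.linear s1 s2 (\<lambda>x. f x y)) \<and>
     (\<forall>x. Vector_Spaces.linear s1 s2 (\<lambda>y. f x y)) \<and>
     (\<forall>x. f x x = 0)"

definition alternating_trilinear ::
  "('k::field \<Rightarrow> 'a::ab_group_add \<Rightarrow> 'a) \<Rightarrow> ('k \<Rightarrow> 'b::ab_group_add \<Rightarrow> 'b) \<Rightarrow>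
   ('a \<Rightarrow> 'a \<Rightarrow> 'a \<Rightarrow> 'b) \<Rightarrow> bool" where
  "alternating_trilinear s1 s2 f \<longleftrightarrow>
     (\<forall>y z. Vector_Spaces.linear s1 s2 (\<lambda>x. f x y z)) \<and>
     (\<forall>x z. Vector_Spaces.linear s1 s2 (\<lambda>y. f x y z)) \<and>
     (\<forall>x y. Vector_Spaces.linear s1 s2 (\<lambda>z. f x y z)) \<and>
     (\<forall>x y. f x x y = 0 \<and> f x y x = 0 \<and> f y x x = 0)"

locale three_Lie_algebra = vector_space scale
  for scale :: "'k::field_char_0 \<Rightarrow> 'g::ab_group_add \<Rightarrow> 'g" +
  fixes br :: "'g \<Rightarrow> 'g \<Rightarrow> 'g \<Rightarrow> 'g"
  assumes bracket_alternating: "alternating_trilinear scale scale br"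
    and fundamental_identity:
      "br x1 x2 (br x3 x4 x5) =
         br (br x1 x2 x3) x4 x5 + br x3 (br x1 x2 x4) x5 + br x3 x4 (br x1 x2 x5)"

locale three_Lie_representation =
  three_Lie_algebra scale br + M: vector_space scaleM
  for scale :: "'k::field_char_0 \<Rightarrow> 'g::ab_group_add \<Rightarrow> 'g"
    and br :: "'g \<Rightarrow> 'g \<Rightarrow> 'g \<Rightarrow> 'g"
    and scaleM :: "'k \<Rightarrow> 'm::ab_group_add \<Rightarrow> 'm" +
  fixes rho :: "'g \<Rightarrow> 'g \<Rightarrow> 'm \<Rightarrow> 'm"
  assumes rho_endomorphism: "Vector_Spaces.linear scaleM scaleM (rho x y)"
    and rho_alternating: "alternating_bilinear scale scaleM (\<lambda>x y. rho x y m)"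
    and rho_rho:
      "rho x1 x2 (rho x3 x4 m) =
         rho (br x1 x2 x3) x4 m + rho x3 (br x1 x2 x4) m + rho x3 x4 (rho x1 x2 m)"
    and rho_bracket:
      "rho x1 (br x2 x3 x4) m =
         rho x3 x4 (rho x1 x2 m) - rho x2 x4 (rho x1 x3 m) + rho x2 x3 (rho x1 x4 m)"

definition rb_bracket ::
  "'k::field_char_0 \<Rightarrow> ('k \<Rightarrow> 'g::ab_group_add \<Rightarrow> 'g) \<Rightarrow> ('g \<Rightarrow> 'g \<Rightarrow> 'g \<Rightarrow> 'g) \<Rightarrow> ('g \<Rightarrow> 'g) \<Rightarrow>
   'g \<Rightarrow> 'g \<Rightarrow> 'g \<Rightarrow> 'g" where
  "rb_bracket lam scale br T x y z =
     br (T x) (T y) z + br (T x) y (T z) + br x (T y) (T z)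
     + scale lam (br (T x) y z) + scale lam (br x (T y) z) + scale lam (br x y (T z))
     + scale (lam ^ 2) (br x y z)"

locale rota_baxter_three_Lie_algebra = three_Lie_algebra scale br
  for lam :: "'k::field_char_0"
    and scale :: "'k \<Rightarrow> 'g::ab_group_add \<Rightarrow> 'g"
    and br :: "'g \<Rightarrow> 'g \<Rightarrow> 'g \<Rightarrow> 'g" +
  fixes T :: "'g \<Rightarrow> 'g"
  assumes T_linear: "Vector_Spaces.linear scale scale T"
    and rota_baxter: "br (T x) (T y) (T z) = T (rb_bracket lam scale br T x y z)"

locale rota_baxter_representation =
  rota_baxter_three_Lie_algebra lam scale br T + three_Lie_representation scale br scaleM rho
  for lam :: "'k::field_char_0"
    and scale :: "'k \<Rightarrow> 'g::ab_group_add \<Rightarrow> 'g"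
    and br :: "'g \<Rightarrow> 'g \<Rightarrow> 'g \<Rightarrow> 'g"
    and T :: "'g \<Rightarrow> 'g"
    and scaleM :: "'k \<Rightarrow> 'm::ab_group_add \<Rightarrow> 'm"
    and rho :: "'g \<Rightarrow> 'g \<Rightarrow> 'm \<Rightarrow> 'm" +
  fixes TM :: "'m \<Rightarrow> 'm"
  assumes TM_linear: "Vector_Spaces.linear scaleM scaleM TM"
    and TM_rota_baxter:
      "rho (T x) (T y) (TM m) =
         TM (rho (T x) (T y) m + rho (T x) y (TM m) + rho x (T y) (TM m)
             + scaleM lam (rho (T x) y m) + scaleM lam (rho x (T y) m)
             + scaleM lam (rho x y (TM m)) + scaleM (lam ^ 2) (rho x y m))"

definition rota_baxter_hom ::
  "('k::field_char_0 \<Rightarrow> 'a::ab_group_add \<Rightarrow> 'a) \<Rightarrow> ('a \<Rightarrow> 'a \<Rightarrow> 'a \<Rightarrow> 'a) \<Rightarrow> ('a \<Rightarrow> 'a) \<Rightarrow>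
   ('k \<Rightarrow> 'b::ab_group_add \<Rightarrow> 'b) \<Rightarrow> ('b \<Rightarrow> 'b \<Rightarrow> 'b \<Rightarrow> 'b) \<Rightarrow> ('b \<Rightarrow> 'b) \<Rightarrow>
   ('a \<Rightarrow> 'b) \<Rightarrow> bool" where
  "rota_baxter_hom scale1 br1 T1 scale2 br2 T2 f \<longleftrightarrow>
     Vector_Spaces.linear scale1 scale2 f \<and>
     (\<forall>x y z. f (br1 x y z) = br2 (f x) (f y) (f z)) \<and>
     (\<forall>x. f (T1 x) = T2 (f x))"

locale abelian_extension =
  M: rota_baxter_three_Lie_algebra lam scaleM "\<lambda>_ _ _. 0" TM +
  H: rota_baxter_three_Lie_algebra lam scaleH brH TH +
  G: rota_baxter_three_Lie_algebra lam scale br T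
  for lam :: "'k::field_char_0"
    and scaleM :: "'k \<Rightarrow> 'm::ab_group_add \<Rightarrow> 'm" and TM :: "'m \<Rightarrow> 'm"
    and scaleH :: "'k \<Rightarrow> 'h::ab_group_add \<Rightarrow> 'h" and brH :: "'h \<Rightarrow> 'h \<Rightarrow> 'h \<Rightarrow> 'h"
    and TH :: "'h \<Rightarrow> 'h"
    and scale :: "'k \<Rightarrow> 'g::ab_group_add \<Rightarrow> 'g" and br :: "'g \<Rightarrow> 'g \<Rightarrow> 'g \<Rightarrow> 'g"
    and T :: "'g \<Rightarrow> 'g" +
  fixes i :: "'m \<Rightarrow> 'h" and p :: "'h \<Rightarrow> 'g"
  assumes i_hom: "rota_baxter_hom scaleM (\<lambda>_ _ _. 0) TM scaleH brH TH i"
    and p_hom: "rota_baxter_hom scaleH brH TH scale br T p"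
    and i_injective: "inj i"
    and exact: "range i = {u. p u = 0}"
    and p_surjective: "surj p"
    and abelian: "brH u (i m) (i n) = 0"

definition is_section ::
  "('k::field_char_0 \<Rightarrow> 'g::ab_group_add \<Rightarrow> 'g) \<Rightarrow> ('k \<Rightarrow> 'h::ab_group_add \<Rightarrow> 'h) \<Rightarrow>
   ('h \<Rightarrow> 'g) \<Rightarrow> ('g \<Rightarrow> 'h) \<Rightarrow> bool" where
  "is_section scale scaleH p s \<longleftrightarrow> Vector_Spaces.linear scale scaleH s \<and> p \<circ> s = id"

text \<open>
  The identification of \<open>M\<close> with \<open>i(M)\<close> is made explicit by \<^term>\<open>inv_into UNIV i\<close>. It is only ever applied to
  elements of the range of \<open>i\<close>: see the three lemmas after the definitions.
\<close>

definition section_rho ::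
  "('h \<Rightarrow> 'h \<Rightarrow> 'h \<Rightarrow> 'h) \<Rightarrow> ('m \<Rightarrow> 'h) \<Rightarrow> ('g \<Rightarrow> 'h) \<Rightarrow> 'g \<Rightarrow> 'g \<Rightarrow> 'm \<Rightarrow> 'm" where
  "section_rho brH i s x y m = inv_into UNIV i (brH (s x) (s y) (i m))"

definition section_psi ::
  "('h::ab_group_add \<Rightarrow> 'h \<Rightarrow> 'h \<Rightarrow> 'h) \<Rightarrow> ('g \<Rightarrow> 'g \<Rightarrow> 'g \<Rightarrow> 'g) \<Rightarrow> ('m \<Rightarrow> 'h) \<Rightarrow> ('g \<Rightarrow> 'h) \<Rightarrow>
   'g \<Rightarrow> 'g \<Rightarrow> 'g \<Rightarrow> 'm" where
  "section_psi brH br i s x y z = inv_into UNIV i (brH (s x) (s y) (s z) - s (br x y z))"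

definition section_chi ::
  "('h::ab_group_add \<Rightarrow> 'h) \<Rightarrow> ('g \<Rightarrow> 'g) \<Rightarrow> ('m \<Rightarrow> 'h) \<Rightarrow> ('g \<Rightarrow> 'h) \<Rightarrow> 'g \<Rightarrow> 'm" where
  "section_chi TH T i s x = inv_into UNIV i (TH (s x) - s (T x))"

context abelian_extension
begin

lemma i_section_rho:
  assumes "is_section scale scaleH p s"
  shows "i (section_rho brH i s x y m) = brH (s x) (s y) (i m)"
proof -
  have pi: "p (i m) = 0" using exact by blast
  have "p (brH (s x) (s y) (i m)) = br (p (s x)) (p (s y)) 0"
    using p_hom pi by (simp add: rota_baxter_hom_def)
  also have "\<dots> = 0"
  proof -
    interpret z: Vector_Spaces.linear scale scale "\<lambda>z. br (p (s x)) (p (s y)) z"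
      using G.bracket_alternating by (simp add: alternating_trilinear_def)
    show ?thesis by (rule z.zero)
  qed
  finally have "brH (s x) (s y) (i m) \<in> range i" using exact by blast
  then show ?thesis by (simp add: section_rho_def f_inv_into_f)
qed

lemma i_section_psi:
  assumes "is_section scale scaleH p s"
  shows "i (section_psi brH br i s x y z) = brH (s x) (s y) (s z) - s (br x y z)"
proof -
  have ps: "p (s v) = v" for v
    using assms by (metis comp_apply id_apply is_section_def)
  interpret p: Vector_Spaces.linear scaleH scale p
    using p_hom by (simp add: rota_baxter_hom_def)
  have "p (brH (s x) (s y) (s z) - s (br x y z)) = 0"
    using p_hom by (simp add: p.diff ps rota_baxter_hom_def)
  then have "brH (s x) (s y) (s z) - s (br x y z) \<in> range i" using exact by blast
  then show ?thesis by (simp add: section_psi_def f_inv_into_f)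
qed

lemma i_section_chi:
  assumes "is_section scale scaleH p s"
  shows "i (section_chi TH T i s x) = TH (s x) - s (T x)"
proof -
  have ps: "p (s v) = v" for v
    using assms by (metis comp_apply id_apply is_section_def)
  interpret p: Vector_Spaces.linear scaleH scale p
    using p_hom by (simp add: rota_baxter_hom_def)
  have "p (TH (s x) - s (T x)) = 0"
    using p_hom by (simp add: p.diff ps rota_baxter_hom_def)
  then have "TH (s x) - s (T x) \<in> range i" using exact by blast
  then show ?thesis by (simp add: section_chi_def f_inv_into_f)
qed

end

definition rho_T ::
  "'k::field_char_0 \<Rightarrow> ('g \<Rightarrow> 'g) \<Rightarrow> ('k \<Rightarrow> 'm::ab_group_add \<Rightarrow> 'm) \<Rightarrow>
   ('g \<Rightarrow> 'g \<Rightarrow> 'm \<Rightarrow> 'm) \<Rightarrow> ('m \<Rightarrow> 'm) \<Rightarrow> 'g \<Rightarrow> 'g \<Rightarrow> 'm \<Rightarrow> 'm" where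
  "rho_T lam T scaleM rho TM x y m =
     rho (T x) (T y) m - TM (rho (T x) y m + rho x (T y) m + scaleM lam (rho x y m))"

definition delta1 ::
  "('g \<Rightarrow> 'g \<Rightarrow> 'g \<Rightarrow> 'g) \<Rightarrow> ('g \<Rightarrow> 'g \<Rightarrow> 'm \<Rightarrow> 'm) \<Rightarrow>
   ('g \<Rightarrow> 'm::ab_group_add) \<Rightarrow> 'g \<Rightarrow> 'g \<Rightarrow> 'g \<Rightarrow> 'm" where
  "delta1 br rho f x y z =
     - f (br x y z) + rho x y (f z) + rho y z (f x) + rho z x (f y)"

definition delta2 ::
  "('g \<Rightarrow> 'g \<Rightarrow> 'g \<Rightarrow> 'g) \<Rightarrow> ('g \<Rightarrow> 'g \<Rightarrow> 'm \<Rightarrow> 'm) \<Rightarrow>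
   ('g \<Rightarrow> 'g \<Rightarrow> 'g \<Rightarrow> 'm::ab_group_add) \<Rightarrow> 'g \<Rightarrow> 'g \<Rightarrow> 'g \<Rightarrow> 'g \<Rightarrow> 'g \<Rightarrow> 'm" where
  "delta2 br rho f x1 x2 x3 x4 x5 =
     - f (br x1 x2 x3) x4 x5 - f x3 (br x1 x2 x4) x5 - f x3 x4 (br x1 x2 x5)
     + f x1 x2 (br x3 x4 x5) + rho x1 x2 (f x3 x4 x5) - rho x3 x4 (f x1 x2 x5)
     - rho x4 x5 (f x1 x2 x3) - rho x5 x3 (f x1 x2 x4)"

definition Phi1 :: "('g \<Rightarrow> 'g) \<Rightarrow> ('m::ab_group_add \<Rightarrow> 'm) \<Rightarrow> ('g \<Rightarrow> 'm) \<Rightarrow> 'g \<Rightarrow> 'm" where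
  "Phi1 T TM f = (f \<circ> T) - (TM \<circ> f)"

definition Phi2 ::
  "'k::field_char_0 \<Rightarrow> ('g \<Rightarrow> 'g) \<Rightarrow> ('k \<Rightarrow> 'm::ab_group_add \<Rightarrow> 'm) \<Rightarrow> ('m \<Rightarrow> 'm) \<Rightarrow>
   ('g \<Rightarrow> 'g \<Rightarrow> 'g \<Rightarrow> 'm) \<Rightarrow> 'g \<Rightarrow> 'g \<Rightarrow> 'g \<Rightarrow> 'm" where
  "Phi2 lam T scaleM TM f x y z =
     f (T x) (T y) (T z)
     - TM (f (T x) (T y) z + f (T x) y (T z) + f x (T y) (T z)
           + scaleM lam (f (T x) y z) + scaleM lam (f x (T y) z) + scaleM lam (f x y (T z))
           + scaleM (lam ^ 2) (f x y z))"

definition partial0 :: "'m \<Rightarrow> 'g \<Rightarrow> 'm::ab_group_add" where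
  "partial0 a = 0"

definition partial1 ::
  "'k::field_char_0 \<Rightarrow> ('k \<Rightarrow> 'g::ab_group_add \<Rightarrow> 'g) \<Rightarrow> ('g \<Rightarrow> 'g \<Rightarrow> 'g \<Rightarrow> 'g) \<Rightarrow> ('g \<Rightarrow> 'g) \<Rightarrow>
   ('k \<Rightarrow> 'm::ab_group_add \<Rightarrow> 'm) \<Rightarrow> ('g \<Rightarrow> 'g \<Rightarrow> 'm \<Rightarrow> 'm) \<Rightarrow> ('m \<Rightarrow> 'm) \<Rightarrow>
   ('g \<Rightarrow> 'm) \<Rightarrow> 'g \<Rightarrow> 'g \<Rightarrow> 'g \<Rightarrow> 'm" where
  "partial1 lam scale br T scaleM rho TM g x y z =
     - g (rb_bracket lam scale br T x y z)
     + rho_T lam T scaleM rho TM x y (g z)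
     + rho_T lam T scaleM rho TM y z (g x)
     + rho_T lam T scaleM rho TM z x (g y)"

definition cochains1 ::
  "('k::field_char_0 \<Rightarrow> 'g::ab_group_add \<Rightarrow> 'g) \<Rightarrow> ('k \<Rightarrow> 'm::ab_group_add \<Rightarrow> 'm) \<Rightarrow>
   (('g \<Rightarrow> 'm) \<times> 'm) set" where
  "cochains1 scale scaleM = {f. Vector_Spaces.linear scale scaleM f} \<times> UNIV"

definition cochains2 ::
  "('k::field_char_0 \<Rightarrow> 'g::ab_group_add \<Rightarrow> 'g) \<Rightarrow> ('k \<Rightarrow> 'm::ab_group_add \<Rightarrow> 'm) \<Rightarrow>
   (('g \<Rightarrow> 'g \<Rightarrow> 'g \<Rightarrow> 'm) \<times> ('g \<Rightarrow> 'm)) set" where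
  "cochains2 scale scaleM =
     {f. alternating_trilinear scale scaleM f} \<times> {g. Vector_Spaces.linear scale scaleM g}"

definition d1 ::
  "('g \<Rightarrow> 'g \<Rightarrow> 'g \<Rightarrow> 'g) \<Rightarrow> ('g \<Rightarrow> 'g) \<Rightarrow> ('g \<Rightarrow> 'g \<Rightarrow> 'm \<Rightarrow> 'm) \<Rightarrow> ('m \<Rightarrow> 'm) \<Rightarrow>
   ('g \<Rightarrow> 'm::ab_group_add) \<times> 'm \<Rightarrow> ('g \<Rightarrow> 'g \<Rightarrow> 'g \<Rightarrow> 'm) \<times> ('g \<Rightarrow> 'm)" where
  "d1 br T rho TM = (\<lambda>(f, a). (delta1 br rho f, - partial0 a - Phi1 T TM f))"

definition d2 ::
  "'k::field_char_0 \<Rightarrow> ('k \<Rightarrow> 'g::ab_group_add \<Rightarrow> 'g) \<Rightarrow> ('g \<Rightarrow> 'g \<Rightarrow> 'g \<Rightarrow> 'g) \<Rightarrow> ('g \<Rightarrow> 'g) \<Rightarrow>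
   ('k \<Rightarrow> 'm::ab_group_add \<Rightarrow> 'm) \<Rightarrow> ('g \<Rightarrow> 'g \<Rightarrow> 'm \<Rightarrow> 'm) \<Rightarrow> ('m \<Rightarrow> 'm) \<Rightarrow>
   ('g \<Rightarrow> 'g \<Rightarrow> 'g \<Rightarrow> 'm) \<times> ('g \<Rightarrow> 'm) \<Rightarrow>
   ('g \<Rightarrow> 'g \<Rightarrow> 'g \<Rightarrow> 'g \<Rightarrow> 'g \<Rightarrow> 'm) \<times> ('g \<Rightarrow> 'g \<Rightarrow> 'g \<Rightarrow> 'm)" where
  "d2 lam scale br T scaleM rho TM =
     (\<lambda>(f, g). (delta2 br rho f,
                - partial1 lam scale br T scaleM rho TM g - Phi2 lam T scaleM TM f))"

text \<open>The additive group of 2-cocycles, with the pointwise operations of \<^theory>\<open>HOL-Library.Function_Algebras\<close>.\<close>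

definition cocycles2 ::
  "'k::field_char_0 \<Rightarrow> ('k \<Rightarrow> 'g::ab_group_add \<Rightarrow> 'g) \<Rightarrow> ('g \<Rightarrow> 'g \<Rightarrow> 'g \<Rightarrow> 'g) \<Rightarrow> ('g \<Rightarrow> 'g) \<Rightarrow>
   ('k \<Rightarrow> 'm::ab_group_add \<Rightarrow> 'm) \<Rightarrow> ('g \<Rightarrow> 'g \<Rightarrow> 'm \<Rightarrow> 'm) \<Rightarrow> ('m \<Rightarrow> 'm) \<Rightarrow>
   (('g \<Rightarrow> 'g \<Rightarrow> 'g \<Rightarrow> 'm) \<times> ('g \<Rightarrow> 'm)) monoid" where
  "cocycles2 lam scale br T scaleM rho TM =
     \<lparr>carrier = {c \<in> cochains2 scale scaleM. d2 lam scale br T scaleM rho TM c = 0},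
      mult = (+), one = 0\<rparr>"

definition coboundaries2 ::
  "('k::field_char_0 \<Rightarrow> 'g::ab_group_add \<Rightarrow> 'g) \<Rightarrow> ('g \<Rightarrow> 'g \<Rightarrow> 'g \<Rightarrow> 'g) \<Rightarrow> ('g \<Rightarrow> 'g) \<Rightarrow>
   ('k \<Rightarrow> 'm::ab_group_add \<Rightarrow> 'm) \<Rightarrow> ('g \<Rightarrow> 'g \<Rightarrow> 'm \<Rightarrow> 'm) \<Rightarrow> ('m \<Rightarrow> 'm) \<Rightarrow>
   (('g \<Rightarrow> 'g \<Rightarrow> 'g \<Rightarrow> 'm) \<times> ('g \<Rightarrow> 'm)) set" where
  "coboundaries2 scale br T scaleM rho TM = d1 br T rho TM ` cochains1 scale scaleM"

definition cohomology2 ::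
  "'k::field_char_0 \<Rightarrow> ('k \<Rightarrow> 'g::ab_group_add \<Rightarrow> 'g) \<Rightarrow> ('g \<Rightarrow> 'g \<Rightarrow> 'g \<Rightarrow> 'g) \<Rightarrow> ('g \<Rightarrow> 'g) \<Rightarrow>
   ('k \<Rightarrow> 'm::ab_group_add \<Rightarrow> 'm) \<Rightarrow> ('g \<Rightarrow> 'g \<Rightarrow> 'm \<Rightarrow> 'm) \<Rightarrow> ('m \<Rightarrow> 'm) \<Rightarrow>
   (('g \<Rightarrow> 'g \<Rightarrow> 'g \<Rightarrow> 'm) \<times> ('g \<Rightarrow> 'm)) set monoid" where
  "cohomology2 lam scale br T scaleM rho TM =
     cocycles2 lam scale br T scaleM rho TM Mod coboundaries2 scale br T scaleM rho TM"

definition cohomology2_class ::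
  "'k::field_char_0 \<Rightarrow> ('k \<Rightarrow> 'g::ab_group_add \<Rightarrow> 'g) \<Rightarrow> ('g \<Rightarrow> 'g \<Rightarrow> 'g \<Rightarrow> 'g) \<Rightarrow> ('g \<Rightarrow> 'g) \<Rightarrow>
   ('k \<Rightarrow> 'm::ab_group_add \<Rightarrow> 'm) \<Rightarrow> ('g \<Rightarrow> 'g \<Rightarrow> 'm \<Rightarrow> 'm) \<Rightarrow> ('m \<Rightarrow> 'm) \<Rightarrow>
   ('g \<Rightarrow> 'g \<Rightarrow> 'g \<Rightarrow> 'm) \<times> ('g \<Rightarrow> 'm) \<Rightarrow> (('g \<Rightarrow> 'g \<Rightarrow> 'g \<Rightarrow> 'm) \<times> ('g \<Rightarrow> 'm)) set" where
  "cohomology2_class lam scale br T scaleM rho TM c =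
     coboundaries2 scale br T scaleM rho TM #>\<^bsub>cocycles2 lam scale br T scaleM rho TM\<^esub> c"

end

theory Submission
  imports Defs
begin

text \<open>
  Fix a section \<open>s\<close>. Modulo \<open>i(M)\<close> the map \<open>s\<close> preserves brackets and operators, and a bracket with two
  entries in \<open>i(M)\<close> vanishes. Hence applying \<open>i\<close> turns the axioms of a representation and the cocycle
  equations into the fundamental and Rota-Baxter identities of the extension, expanded along
  \<open>brH (s x) (s y) (s z) = s (br x y z) + i (psi x y z)\<close> and \<open>TH (s x) = s (T x) + i (chi x)\<close>.
  Two sections differ by \<open>i \<circ> f\<close> with \<open>f\<close> linear; this does not change the action on \<open>M\<close>, and it
  changes \<open>(psi, chi)\<close> by \<open>d1 (f, 0)\<close>.
\<close>

section \<open>Linear maps between vector spaces\<close>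

lemma linearI':
  assumes "vector_space s1" "vector_space s2"
    and "\<And>x y. f (x + y) = f x + f y" and "\<And>c x. f (s1 c x) = s2 c (f x)"
  shows "Vector_Spaces.linear s1 s2 f"
  using assms
  by (simp add: Vector_Spaces.linear_def module_hom_def module_hom_axioms_def
      vector_space_def module_def)

lemma linear_addD: "Vector_Spaces.linear s1 s2 f \<Longrightarrow> f (x + y) = f x + f y"
  by (simp add: Vector_Spaces.linear_def module_hom_def module_hom_axioms_def)

lemma linear_scaleD: "Vector_Spaces.linear s1 s2 f \<Longrightarrow> f (s1 c x) = s2 c (f x)"
  by (simp add: Vector_Spaces.linear_def module_hom_def module_hom_axioms_def)

lemma linear_zeroD: "Vector_Spaces.linear s1 s2 f \<Longrightarrow> f 0 = 0"
  using linear_addD[of s1 s2 f 0 0] by simp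

lemma linear_minusD:
  assumes "Vector_Spaces.linear s1 s2 f"
  shows "f (- x) = - f x"
  using linear_addD[OF assms, of x "- x"] linear_zeroD[OF assms]
  by (simp add: eq_neg_iff_add_eq_0 add.commute)

lemma linear_diffD:
  assumes "Vector_Spaces.linear s1 s2 f"
  shows "f (x - y) = f x - f y"
  using linear_addD[OF assms, of x "- y"] linear_minusD[OF assms] by simp

lemma linear_diff:
  assumes "Vector_Spaces.linear s1 s2 f" and "Vector_Spaces.linear s1 s2 g"
  shows "Vector_Spaces.linear s1 s2 (f - g)"
proof -
  interpret f: Vector_Spaces.linear s1 s2 f by fact
  interpret g: Vector_Spaces.linear s1 s2 g by fact
  show ?thesis
    by (rule linearI')
      (use f.vs1.vector_space_axioms f.vs2.vector_space_axioms in
        \<open>simp_all add: f.add g.add f.scale g.scale f.vs2.scale_right_diff_distrib\<close>)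
qed

section \<open>Symmetries of alternating trilinear maps\<close>

context
  fixes s1 :: "'k::field \<Rightarrow> 'a::ab_group_add \<Rightarrow> 'a" and s2 :: "'k \<Rightarrow> 'b::ab_group_add \<Rightarrow> 'b"
    and f :: "'a \<Rightarrow> 'a \<Rightarrow> 'a \<Rightarrow> 'b"
  assumes f: "alternating_trilinear s1 s2 f"
begin

lemma trilinear:
  "Vector_Spaces.linear s1 s2 (\<lambda>x. f x y z)"
  "Vector_Spaces.linear s1 s2 (\<lambda>y. f x y z)"
  "Vector_Spaces.linear s1 s2 (\<lambda>z. f x y z)"
  using f by (simp_all add: alternating_trilinear_def)

lemmas trilinear_add =
  trilinear(1)[THEN linear_addD] trilinear(2)[THEN linear_addD] trilinear(3)[THEN linear_addD]

lemmas trilinear_simps = trilinear_add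
  trilinear(1)[THEN linear_diffD] trilinear(2)[THEN linear_diffD] trilinear(3)[THEN linear_diffD]
  trilinear(1)[THEN linear_minusD] trilinear(2)[THEN linear_minusD] trilinear(3)[THEN linear_minusD]
  trilinear(1)[THEN linear_scaleD] trilinear(2)[THEN linear_scaleD] trilinear(3)[THEN linear_scaleD]
  trilinear(1)[THEN linear_zeroD] trilinear(2)[THEN linear_zeroD] trilinear(3)[THEN linear_zeroD]

lemma trilinear_alternating: "f x x y = 0" "f x y x = 0" "f y x x = 0"
  using f by (simp_all add: alternating_trilinear_def)

text \<open>Polarization: expanding \<open>f (x + y) (x + y) z = 0\<close> leaves the two mixed
  terms.\<close>

lemma trilinear_swap12: "f y x z = - f x y z"
proof -
  have "f x y z + f y x z = 0"
    using trilinear_alternating(1)[of "x + y" z]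
    unfolding trilinear_add by (simp add: trilinear_alternating add.commute)
  then show ?thesis by (rule minus_unique[symmetric])
qed

lemma trilinear_swap23: "f x z y = - f x y z"
proof -
  have "f x y z + f x z y = 0"
    using trilinear_alternating(3)[of x "y + z"]
    unfolding trilinear_add by (simp add: trilinear_alternating add.commute)
  then show ?thesis by (rule minus_unique[symmetric])
qed

text \<open>A 3-cycle is a product of two transpositions, so the signs cancel.\<close>

lemma trilinear_rotate: "f x y z = f y z x"
  using trilinear_swap12[of x y z] trilinear_swap23[of y z x] by simp

end

section \<open>Calculus in an extension with a fixed section\<close>

locale extension_with_section =
  abelian_extension lam scaleM TM scaleH brH TH scale br T i p
  for lam :: "'k::field_char_0"
    and scaleM :: "'k \<Rightarrow> 'm::ab_group_add \<Rightarrow> 'm" and TM :: "'m \<Rightarrow> 'm"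
    and scaleH :: "'k \<Rightarrow> 'h::ab_group_add \<Rightarrow> 'h" and brH :: "'h \<Rightarrow> 'h \<Rightarrow> 'h \<Rightarrow> 'h"
    and TH :: "'h \<Rightarrow> 'h"
    and scale :: "'k \<Rightarrow> 'g::ab_group_add \<Rightarrow> 'g" and br :: "'g \<Rightarrow> 'g \<Rightarrow> 'g \<Rightarrow> 'g"
    and T :: "'g \<Rightarrow> 'g" and i :: "'m \<Rightarrow> 'h" and p :: "'h \<Rightarrow> 'g" +
  fixes s :: "'g \<Rightarrow> 'h"
  assumes section_s: "is_section scale scaleH p s"
begin

abbreviation rho where "rho \<equiv> section_rho brH i s"
abbreviation psi where "psi \<equiv> section_psi brH br i s"
abbreviation chi where "chi \<equiv> section_chi TH T i s"

lemma i_linear: "Vector_Spaces.linear scaleM scaleH i"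
  using i_hom by (simp add: rota_baxter_hom_def)

lemmas i_simps = i_linear[THEN linear_addD] i_linear[THEN linear_diffD]
  i_linear[THEN linear_minusD] i_linear[THEN linear_scaleD] i_linear[THEN linear_zeroD]

lemma i_TM: "i (TM m) = TH (i m)"
  using i_hom by (simp add: rota_baxter_hom_def)

text \<open>Moves identities in \<open>M\<close> into the extension, where the
  \<open>inv_into\<close> hidden in \<open>rho\<close>, \<open>psi\<close> and \<open>chi\<close>
  cancels by \<open>i_section_rho\<close>, \<open>i_section_psi\<close> and
  \<open>i_section_chi\<close>.\<close>

lemma i_eqD: "i a = i b \<Longrightarrow> a = b"
  using i_injective by (simp add: inj_eq)

lemma s_linear: "Vector_Spaces.linear scale scaleH s"
  using section_s by (simp add: is_section_def)

lemmas s_simps = s_linear[THEN linear_addD] s_linear[THEN linear_diffD]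
  s_linear[THEN linear_minusD] s_linear[THEN linear_scaleD] s_linear[THEN linear_zeroD]

lemma p_s: "p (s x) = x"
  using section_s by (metis comp_apply id_apply is_section_def)

lemmas T_simps = G.T_linear[THEN linear_addD] G.T_linear[THEN linear_diffD]
  G.T_linear[THEN linear_minusD] G.T_linear[THEN linear_scaleD] G.T_linear[THEN linear_zeroD]

lemmas TM_simps = M.T_linear[THEN linear_addD] M.T_linear[THEN linear_diffD]
  M.T_linear[THEN linear_minusD] M.T_linear[THEN linear_scaleD] M.T_linear[THEN linear_zeroD]

lemmas TH_simps = H.T_linear[THEN linear_addD] H.T_linear[THEN linear_diffD]
  H.T_linear[THEN linear_minusD] H.T_linear[THEN linear_scaleD] H.T_linear[THEN linear_zeroD]

lemmas brH_simps = trilinear_simps[OF H.bracket_alternating]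

lemmas br_simps = trilinear_simps[OF G.bracket_alternating]

lemmas scale_simps = H.scale_right_distrib H.scale_right_diff_distrib H.scale_minus_right
  H.scale_zero_right H.scale_scale

lemmas i_rho = i_section_rho[OF section_s]

lemma rho_linear: "Vector_Spaces.linear scaleM scaleM (rho x y)"
  by (intro linearI' M.vector_space_axioms i_eqD) (simp_all add: i_rho i_simps brH_simps)

lemma rho_alternating: "alternating_bilinear scale scaleM (\<lambda>x y. rho x y m)"
  unfolding alternating_bilinear_def
  by (intro conjI allI linearI' G.vector_space_axioms M.vector_space_axioms i_eqD)
    (simp_all add: i_rho i_simps s_simps brH_simps trilinear_alternating[OF H.bracket_alternating])

lemma rho_skew: "rho y x m = - rho x y m"
  by (rule i_eqD) (simp add: i_rho i_simps trilinear_swap12[OF H.bracket_alternating, of "s x" "s y"])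

lemma brH_section: "brH (s x) (s y) (s z) = s (br x y z) + i (psi x y z)"
  by (simp add: i_section_psi[OF section_s])

lemma TH_section: "TH (s x) = s (T x) + i (chi x)"
  by (simp add: i_section_chi[OF section_s])

text \<open>In \<open>abelian\<close> the entries from \<open>range i\<close> come last; rotation
  reaches the other positions.\<close>

lemma brH_abelian: "brH u (i m) (i n) = 0" "brH (i m) u (i n) = 0" "brH (i m) (i n) u = 0"
  using abelian[of u m n] abelian[of u n m]
    trilinear_rotate[OF H.bracket_alternating, of "i m" u "i n"]
    trilinear_rotate[OF H.bracket_alternating, of u "i m" "i n"]
  by simp_all

text \<open>Rotation moves \<open>i m\<close> to the last slot. From the middle slot this reverses
  \<open>s x\<close> and \<open>s y\<close>, which absorbs the sign.\<close>

lemma brH_i: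
  "brH (s x) (s y) (i m) = i (rho x y m)"
  "brH (s x) (i m) (s y) = i (rho y x m)"
  "brH (i m) (s x) (s y) = i (rho x y m)"
  by (simp_all add: i_rho trilinear_rotate[OF H.bracket_alternating, of "i m"]
      trilinear_rotate[OF H.bracket_alternating, of "s y" "s x" "i m"])

text \<open>Rewrites brackets and operator values in the extension into sums of terms \<open>s x\<close> and \<open>i m\<close>.\<close>

lemmas split_simps = brH_section TH_section brH_abelian brH_i i_TM[symmetric]
  i_simps s_simps TM_simps TH_simps brH_simps scale_simps

section \<open>The induced representation on \<open>M\<close>\<close>

lemma rho_rho:
  "rho x1 x2 (rho x3 x4 m) =
     rho (br x1 x2 x3) x4 m + rho x3 (br x1 x2 x4) m + rho x3 x4 (rho x1 x2 m)"
  \<comment> \<open>Each \<open>psi\<close> term shares a bracket with \<open>i m\<close> and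
    vanishes.\<close>
  using H.fundamental_identity[of "s x1" "s x2" "s x3" "s x4" "i m"]
  by (intro i_eqD) (simp add: split_simps)

lemma rho_bracket:
  "rho x1 (br x2 x3 x4) m =
     rho x3 x4 (rho x1 x2 m) - rho x2 x4 (rho x1 x3 m) + rho x2 x3 (rho x1 x4 m)"
proof -
  note minus = rho_linear[THEN linear_minusD]
  \<comment> \<open>With \<open>i m\<close> in second place the fundamental identity gives a cyclic
    form without signs; reversing the pairs with \<open>x1\<close> and the pair \<open>x4\<close>,
    \<open>x2\<close> then leaves a single minus sign.\<close>
  have "rho (br x2 x3 x4) x1 m =
      rho x3 x4 (rho x2 x1 m) + rho x4 x2 (rho x3 x1 m) + rho x2 x3 (rho x4 x1 m)"
    using H.fundamental_identity[of "s x1" "i m" "s x2" "s x3" "s x4"]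
    by (intro i_eqD) (simp add: split_simps)
  then show ?thesis
    by (simp add: rho_skew[of x1] rho_skew[of x4 x2] minus)
qed

lemma TM_rota_baxter:
  "rho (T x) (T y) (TM m) =
     TM (rho (T x) (T y) m + rho (T x) y (TM m) + rho x (T y) (TM m)
         + scaleM lam (rho (T x) y m) + scaleM lam (rho x (T y) m)
         + scaleM lam (rho x y (TM m)) + scaleM (lam ^ 2) (rho x y m))"
  \<comment> \<open>Every \<open>chi\<close> value meets \<open>i m\<close> or
    \<open>i (TM m)\<close> in a bracket, so none survives.\<close>
  using H.rota_baxter[of "s x" "s y" "i m"]
  by (intro i_eqD) (simp add: rb_bracket_def split_simps)

lemma representation: "rota_baxter_representation lam scale br T scaleM rho TM"
  by (intro rota_baxter_representation.intro three_Lie_representation.intro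
      three_Lie_representation_axioms.intro rota_baxter_representation_axioms.intro
      G.rota_baxter_three_Lie_algebra_axioms G.three_Lie_algebra_axioms M.vector_space_axioms
      rho_linear rho_alternating rho_rho rho_bracket M.T_linear TM_rota_baxter)

section \<open>The 2-cocycle of the section\<close>

lemma psi_alternating: "alternating_trilinear scale scaleM psi"
  unfolding alternating_trilinear_def
  by (intro conjI allI linearI' G.vector_space_axioms M.vector_space_axioms i_eqD)
    (simp_all add: i_section_psi[OF section_s] i_simps s_simps brH_simps br_simps scale_simps
      trilinear_alternating[OF H.bracket_alternating] trilinear_alternating[OF G.bracket_alternating])

lemma chi_linear: "Vector_Spaces.linear scale scaleM chi"
  by (intro linearI' G.vector_space_axioms M.vector_space_axioms i_eqD)
    (simp_all add: i_section_chi[OF section_s] i_simps s_simps T_simps TH_simps scale_simps)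

lemma delta2_psi: "delta2 br rho psi = 0"
proof (intro ext i_eqD)
  fix x1 x2 x3 x4 x5
  show "i (delta2 br rho psi x1 x2 x3 x4 x5) = i (0 x1 x2 x3 x4 x5)"
    \<comment> \<open>The summands under \<open>s\<close> cancel by the identity of the base; those
      under \<open>i\<close> form \<open>delta2\<close>.\<close>
    using H.fundamental_identity[of "s x1" "s x2" "s x3" "s x4" "s x5"]
      G.fundamental_identity[of x1 x2 x3 x4 x5]
    by (simp add: delta2_def split_simps algebra_simps)
qed

lemma partial1_chi: "partial1 lam scale br T scaleM rho TM chi + Phi2 lam T scaleM TM psi = 0"
proof (intro ext i_eqD)
  fix x y z
  note chi_simps = chi_linear[THEN linear_addD] chi_linear[THEN linear_scaleD]
  show "i ((partial1 lam scale br T scaleM rho TM chi + Phi2 lam T scaleM TM psi) x y z) =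
      i (0 x y z)"
    \<comment> \<open>Brackets with two \<open>chi\<close> values vanish, those with one assemble
      into \<open>rho_T\<close>, and the \<open>psi\<close> terms form \<open>Phi2\<close>. Applying
      \<open>TH\<close> to the lift of \<open>rb_bracket\<close> yields its \<open>chi\<close>
      term.\<close>
    using H.rota_baxter[of "s x" "s y" "s z"] G.rota_baxter[of x y z]
    by (simp add: partial1_def Phi2_def rho_T_def rb_bracket_def split_simps T_simps chi_simps
        algebra_simps)
qed

lemma cocycle: "(psi, chi) \<in> carrier (cocycles2 lam scale br T scaleM rho TM)"
proof -
  \<comment> \<open>The second component of \<open>d2\<close> is the negative of the sum in
    \<open>partial1_chi\<close>.\<close>
  have "- partial1 lam scale br T scaleM rho TM chi - Phi2 lam T scaleM TM psi =
      - (partial1 lam scale br T scaleM rho TM chi + Phi2 lam T scaleM TM psi)"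
    by simp
  then show ?thesis
    by (simp add: cocycles2_def cochains2_def d2_def psi_alternating chi_linear delta2_psi
        partial1_chi zero_prod_def)
qed

section \<open>Comparison of two sections\<close>

lemma other_section:
  assumes "is_section scale scaleH p s'"
  obtains f where "Vector_Spaces.linear scale scaleM f" and "\<And>x. s' x = s x + i (f x)"
proof
  \<comment> \<open>Both sections lift the identity, so \<open>s' x - s x\<close> lies in the kernel
    of \<open>p\<close>, which is \<open>range i\<close>.\<close>
  define f where "f x = inv_into UNIV i (s' x - s x)" for x
  have s': "Vector_Spaces.linear scale scaleH s'" and p_s': "p (s' x) = x" for x
    using assms by (auto simp: is_section_def fun_eq_iff)
  have p: "Vector_Spaces.linear scaleH scale p"
    using p_hom by (simp add: rota_baxter_hom_def)
  have "s' x - s x \<in> range i" for x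
    using exact by (simp add: linear_diffD[OF p] p_s p_s')
  then have i_f: "i (f x) = s' x - s x" for x
    by (simp add: f_def f_inv_into_f)
  show "s' x = s x + i (f x)" for x
    by (simp add: i_f)
  show "Vector_Spaces.linear scale scaleM f"
    by (intro linearI' G.vector_space_axioms M.vector_space_axioms i_eqD)
      (simp_all add: i_f i_simps s_simps scale_simps s'[THEN linear_addD] s'[THEN linear_scaleD])
qed

context
  fixes s' f
  assumes s': "is_section scale scaleH p s'"
    and f: "Vector_Spaces.linear scale scaleM f"
    and s'_eq: "\<And>x. s' x = s x + i (f x)"
begin

text \<open>Each correction \<open>i (f x)\<close> or \<open>i (f y)\<close> stands beside
  \<open>i m\<close> in a bracket and vanishes.\<close>

lemma rho_other: "section_rho brH i s' = rho"
  by (intro ext i_eqD) (simp add: i_section_rho[OF s'] s'_eq split_simps)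

text \<open>Brackets with several values of \<open>f\<close> vanish; those with one give the
  \<open>rho\<close> terms of \<open>delta1\<close>, and \<open>- s' (br x y z)\<close> contributes
  \<open>- f (br x y z)\<close>.\<close>

lemma psi_other: "section_psi brH br i s' = delta1 br rho f + psi"
  by (intro ext i_eqD)
    (simp add: i_section_psi[OF s'] s'_eq delta1_def split_simps algebra_simps)

text \<open>Since \<open>TH (i (f x)) = i (TM (f x))\<close>, the change is
  \<open>TM (f x) - f (T x)\<close>; its sign matches the minus before \<open>Phi1\<close> in
  \<open>d1\<close>.\<close>

lemma chi_other: "section_chi TH T i s' = chi - Phi1 T TM f"
  by (intro ext i_eqD)
    (simp add: i_section_chi[OF s'] s'_eq Phi1_def split_simps algebra_simps)

lemma cocycle_other:
  "(section_psi brH br i s', section_chi TH T i s') = d1 br T rho TM (f, 0) + (psi, chi)"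
  by (simp add: d1_def partial0_def psi_other chi_other)

end

end

section \<open>Cohomology classes as cosets of the coboundaries\<close>

context rota_baxter_representation
begin

lemma d1_diff: "d1 br T rho TM (f - g, a - b) = d1 br T rho TM (f, a) - d1 br T rho TM (g, b)"
proof -
  have "delta1 br rho (f - g) = delta1 br rho f - delta1 br rho g"
    by (simp add: fun_eq_iff delta1_def rho_endomorphism[THEN linear_diffD])
  moreover have "Phi1 T TM (f - g) = Phi1 T TM f - Phi1 T TM g"
    by (simp add: fun_eq_iff Phi1_def TM_linear[THEN linear_diffD])
  ultimately show ?thesis
    by (simp add: d1_def partial0_def)
qed

text \<open>The subgroup criterion in difference form, from which negatives and sums of coboundaries
  follow.\<close>

lemma coboundaries2_diff:
  assumes "b \<in> coboundaries2 scale br T scaleM rho TM"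
    and "c \<in> coboundaries2 scale br T scaleM rho TM"
  shows "b - c \<in> coboundaries2 scale br T scaleM rho TM"
proof -
  from assms obtain f u g v where "Vector_Spaces.linear scale scaleM f" "b = d1 br T rho TM (f, u)"
    "Vector_Spaces.linear scale scaleM g" "c = d1 br T rho TM (g, v)"
    by (auto simp: coboundaries2_def cochains1_def)
  then have "b - c = d1 br T rho TM (f - g, u - v)" "(f - g, u - v) \<in> cochains1 scale scaleM"
    by (auto simp: d1_diff cochains1_def intro: linear_diff)
  then show ?thesis by (auto simp: coboundaries2_def)
qed

lemma cohomology2_class_eq:
  "cohomology2_class lam scale br T scaleM rho TM c =
     (\<lambda>b. b + c) ` coboundaries2 scale br T scaleM rho TM"
  by (auto simp: cohomology2_class_def r_coset_def cocycles2_def)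

lemma cohomology2_class_add_coboundary:
  assumes d: "d \<in> coboundaries2 scale br T scaleM rho TM"
  shows "cohomology2_class lam scale br T scaleM rho TM (d + c) =
    cohomology2_class lam scale br T scaleM rho TM c"
proof -
  let ?B = "coboundaries2 scale br T scaleM rho TM"
  \<comment> \<open>Here \<open>- d\<close> is read as \<open>(d - d) - d\<close>, and below
    \<open>b + d\<close> as \<open>b - (- d)\<close>.\<close>
  have "- d \<in> ?B"
    using coboundaries2_diff[OF coboundaries2_diff[OF d d] d] by simp
  then have "b + d \<in> ?B" if "b \<in> ?B" for b
    using coboundaries2_diff[OF that] by fastforce
  \<comment> \<open>Translation by \<open>d\<close> maps the coboundaries onto themselves:
    \<open>b\<close> has the preimage \<open>b - d\<close>.\<close>
  then have "(\<lambda>b. b + d) ` ?B = ?B"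
    using coboundaries2_diff[OF _ d] by (force simp: image_iff intro: bexI[of _ "_ - d"])
  then have "(\<lambda>b. b + c) ` (\<lambda>b. b + d) ` ?B = (\<lambda>b. b + c) ` ?B" by simp
  then show ?thesis
    by (simp add: cohomology2_class_eq image_image add.assoc)
qed

text \<open>The carrier of a factor group consists of the cosets of carrier elements, here of
  cocycles.\<close>

lemma cohomology2_class_in_carrier:
  assumes "c \<in> carrier (cocycles2 lam scale br T scaleM rho TM)"
  shows "cohomology2_class lam scale br T scaleM rho TM c
    \<in> carrier (cohomology2 lam scale br T scaleM rho TM)"
  using assms by (auto simp: cohomology2_def cohomology2_class_def FactGroup_def RCOSETS_def)

end

theorem proposition5p5:
  fixes lam :: "'k::field_char_0"
    and scaleM :: "'k \<Rightarrow> 'm::ab_group_add \<Rightarrow> 'm" and TM :: "'m \<Rightarrow> 'm"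
    and scaleH :: "'k \<Rightarrow> 'h::ab_group_add \<Rightarrow> 'h" and brH :: "'h \<Rightarrow> 'h \<Rightarrow> 'h \<Rightarrow> 'h"
    and TH :: "'h \<Rightarrow> 'h"
    and scale :: "'k \<Rightarrow> 'g::ab_group_add \<Rightarrow> 'g" and br :: "'g \<Rightarrow> 'g \<Rightarrow> 'g \<Rightarrow> 'g"
    and T :: "'g \<Rightarrow> 'g"
    and i :: "'m \<Rightarrow> 'h" and p :: "'h \<Rightarrow> 'g"
    and s s' :: "'g \<Rightarrow> 'h"
  assumes "abelian_extension lam scaleM TM scaleH brH TH scale br T i p"
    and "is_section scale scaleH p s"
    and "is_section scale scaleH p s'"
  shows
    "(rota_baxter_representation lam scale br T scaleM (section_rho brH i s) TM \<and>
      section_rho brH i s' = section_rho brH i s) \<and>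
     (section_psi brH br i s, section_chi TH T i s)
        \<in> carrier (cocycles2 lam scale br T scaleM (section_rho brH i s) TM) \<and>
     cohomology2_class lam scale br T scaleM (section_rho brH i s) TM
         (section_psi brH br i s, section_chi TH T i s)
       \<in> carrier (cohomology2 lam scale br T scaleM (section_rho brH i s) TM) \<and>
     cohomology2_class lam scale br T scaleM (section_rho brH i s') TM
         (section_psi brH br i s', section_chi TH T i s')
       = cohomology2_class lam scale br T scaleM (section_rho brH i s) TM
         (section_psi brH br i s, section_chi TH T i s)"
proof -
  interpret extension_with_section lam scaleM TM scaleH brH TH scale br T i p s
    using assms(1,2) by (simp add: extension_with_section_def extension_with_section_axioms_def)
  interpret R: rota_baxter_representation lam scale br T scaleM rho TM
    by (rule representation)
  obtain f where f: "Vector_Spaces.linear scale scaleM f" "\<And>x. s' x = s x + i (f x)"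
    using other_section[OF assms(3)] by blast
  \<comment> \<open>By \<open>rho_other\<close> both classes lie in the same group; by
    \<open>cocycle_other\<close> the cocycles differ by this coboundary, which the class
    absorbs.\<close>
  have "d1 br T rho TM (f, 0) \<in> coboundaries2 scale br T scaleM rho TM"
    using f(1) by (simp add: coboundaries2_def cochains1_def)
  then show ?thesis
    using representation cocycle R.cohomology2_class_in_carrier[OF cocycle]
    by (simp add: rho_other[OF assms(3) f] cocycle_other[OF assms(3) f]
        R.cohomology2_class_add_coboundary)
qed

end
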